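(* Let $(X,d)$ be a complete metric space, $(Y,\varrho)$ be a complete linear metric space with a shift-invariant metric, and let a point $(\bar x,\bar y,\bar z)\in X\times Y\times Y$ be given. Consider set-valued mappings $F,G:X\rightrightarrows Y$ such that $F$ has a locally closed graph around $(\bar x,\bar y)\in\mathrm{gph}\,F$ and $G$ has a locally closed graph around $(\bar x,\bar z)\in\mathrm{gph}\,G$. Then $$\mathrm{lopen}\,(F+G)(\bar x,\bar y+\bar z)\ \ge\ \mathrm{sur}\,F(\bar x,\bar y)-\mathrm{lip}\,G(\bar x,\bar z).$$
   Context: $\mathbb{B}[u,r]$ is the closed ball with centre $u$ and radius $r>0$. $F:X\rightrightarrows Y$ is a set-valued mapping (values may be empty), $\mathrm{gph}\,F=\{(x,y):y\in F(x)\}$, $F(C)=\bigcup_{x\in C}F(x)$; $(F+G)(x)=F(x)+G(x)$. A linear metric space with shift-invariant metric is a vector space with a metric for which the vector operations are continuous and $\varrho(y+w,y'+w)=\varrho(y,y')$. A graph is locally closed around a point of it if its intersection with some closed neighborhood of that point is closed. $\mathrm{dist}(y,C)=\inf\{\varrho(y,u):u\in C\}$, $\inf\emptyset=\infty$, $\sup\emptyset=0$. For a set-valued mapping $H:X\rightrightarrows Y$ and $(\bar x,\bar w)\in\mathrm{gph}\,H$: - $\mathrm{lopen}\,H(\bar x,\bar w)$ is the supremum of all $c>0$ for which there is $\varepsilon>0$ such that $\mathbb{B}[\bar w,ct]\subset H(\mathbb{B}[\bar x,t])$ for each $t\in(0,\varepsilon)$; - $\mathrm{sur}\,H(\bar x,\bar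 w)$ is the supremum of all $c>0$ for which there are $\varepsilon>0$ and a neighborhood $U\times V$ of $(\bar x,\bar w)$ such that $\mathbb{B}[y,ct]\subset H(\mathbb{B}[x,t])$ whenever $(x,y)\in U\times V$, $y\in H(x)$, $t\in(0,\varepsilon)$; - $\mathrm{lip}\,H(\bar x,\bar w)$ is the infimum of all $\mu>0$ for which there is a neighborhood $U\times V$ of $(\bar x,\bar w)$ such that $\mathrm{dist}(y,H(x))\le\mu\,d(x,x')$ whenever $x,x'\in U$ and $y\in H(x')\cap V$. The inequality is regarded as trivially true when $\mathrm{sur}\,F(\bar x,\bar y)\le\mathrm{lip}\,G(\bar x,\bar z)$ (including the case when both are $\infty$). *)

theory Defs
  imports "HOL-Analysis.Analysis" "HOL-Library.Set_Algebras"
begin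

text \<open>
  Set-valued mappings are functions into sets, and values may be empty. The pointwise sum of
  two values is the Minkowski sum of \<open>HOL-Library.Set_Algebras\<close>.
\<close>

class linear_metric_space = real_vector + metric_space + topological_ab_group_add +
  assumes tendsto_scaleR_Pair:
    "LIM p (nhds r \<times>\<^sub>F nhds x). fst p *\<^sub>R snd p :> nhds (r *\<^sub>R x)"

text \<open>Every normed space is an instance.\<close>

instance real_normed_vector \<subseteq> linear_metric_space
proof
  show "LIM p (nhds r \<times>\<^sub>F nhds x). fst p *\<^sub>R snd p :> nhds (r *\<^sub>R x)" for r and x :: 'a
    by (intro tendsto_scaleR filterlim_fst filterlim_snd)
qed

definition shift_invariant_metric :: "'y::linear_metric_space itself \<Rightarrow> bool" where
  "shift_invariant_metric _ \<longleftrightarrow> (\<forall>y y' w :: 'y. dist (y + w) (y' + w) = dist y y')"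

definition gph :: "('x \<Rightarrow> 'y set) \<Rightarrow> ('x \<times> 'y) set" where
  "gph H = {(x, y). y \<in> H x}"

definition image_of :: "('x \<Rightarrow> 'y set) \<Rightarrow> 'x set \<Rightarrow> 'y set" where
  "image_of H C = (\<Union>x\<in>C. H x)"

definition locally_closed_around :: "'a::topological_space set \<Rightarrow> 'a \<Rightarrow> bool" where
  "locally_closed_around S p \<longleftrightarrow> (\<exists>N. closed N \<and> p \<in> interior N \<and> closed (S \<inter> N))"

text \<open>
  The library function \<^const>\<open>infdist\<close> is real-valued and 0 on the empty set. Here the distance
  to the empty set is \<open>\<infinity>\<close>, since the infimum is taken in \<^typ>\<open>ereal\<close>.
\<close>

definition edist_to :: "'y::metric_space \<Rightarrow> 'y set \<Rightarrow> ereal" where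
  "edist_to y C = (INF u\<in>C. ereal (dist y u))"

text \<open>
  In \<^typ>\<open>ereal\<close> the supremum of the empty set is \<open>-\<infinity>\<close>; inserting 0 into the sets of positive
  numbers below realises the convention that it is 0.
\<close>

definition lopen ::
    "('x::metric_space \<Rightarrow> 'y::metric_space set) \<Rightarrow> 'x \<Rightarrow> 'y \<Rightarrow> ereal" where
  "lopen H xb wb = Sup (insert 0 {ereal c | c. c > 0 \<and>
     (\<exists>\<epsilon>>0. \<forall>t\<in>{0<..<\<epsilon>}. cball wb (c * t) \<subseteq> image_of H (cball xb t))})"

definition sur ::
    "('x::metric_space \<Rightarrow> 'y::metric_space set) \<Rightarrow> 'x \<Rightarrow> 'y \<Rightarrow> ereal" where
  "sur H xb wb = Sup (insert 0 {ereal c | c. c > 0 \<and>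
     (\<exists>\<epsilon>>0. \<exists>U V. open U \<and> xb \<in> U \<and> open V \<and> wb \<in> V \<and>
        (\<forall>x\<in>U. \<forall>y\<in>V. y \<in> H x \<longrightarrow>
           (\<forall>t\<in>{0<..<\<epsilon>}. cball y (c * t) \<subseteq> image_of H (cball x t))))})"

definition lip ::
    "('x::metric_space \<Rightarrow> 'y::metric_space set) \<Rightarrow> 'x \<Rightarrow> 'y \<Rightarrow> ereal" where
  "lip H xb wb = Inf {ereal \<mu> | \<mu>. \<mu> > 0 \<and>
     (\<exists>U V. open U \<and> xb \<in> U \<and> open V \<and> wb \<in> V \<and>
        (\<forall>x\<in>U. \<forall>x'\<in>U. \<forall>y\<in>H x' \<inter> V. edist_to y (H x) \<le> ereal (\<mu> * dist x x')))}"

end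

theory Submission
  imports Defs
begin

text \<open>
  Let \<open>F\<close> be open at the linear rate \<open>a\<close> near \<open>(xb, yb)\<close> and let \<open>G\<close> have the Aubin property with
  a constant smaller than \<open>m\<close> near \<open>(xb, zb)\<close>, where \<open>m < a\<close>. To solve \<open>w \<in> F x + G x\<close> one
  iterates as in the Lyusternik-Graves theorem. Suppose that \<open>y \<in> F x\<close>, \<open>z \<in> G x\<close>, and put
  \<open>r = \<rho>(y + z, w)\<close>. Openness of \<open>F\<close> yields \<open>x'\<close> within \<open>r / a\<close> of \<open>x\<close> such that
  \<open>w - z \<in> F x'\<close>, and the Aubin property of \<open>G\<close> yields \<open>z' \<in> G x'\<close> within \<open>m r / a\<close> of \<open>z\<close>.
  By shift invariance the residual of \<open>(w - z) + z'\<close> is \<open>r' = \<rho>(z', z) \<le> m r / a\<close>. Hence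

    \<open>(a - m) d(x, x') \<le> r - r'\<close> and \<open>(a - m) \<rho>(z, z') \<le> m (r - r')\<close>,

  so the residual pays for the motion of \<open>x\<close> and of \<open>z\<close>: both sequences are Cauchy, and the
  total displacement of \<open>x\<close> is at most \<open>\<rho>(yb + zb, w) / (a - m)\<close>
  (lemmas \<open>residual_step\<close> and \<open>sum_covers_ball\<close>). The limits lie on the two graphs because these
  are locally closed, and their sum is \<open>w\<close>. Therefore \<open>F + G\<close> is open at \<open>(xb, yb + zb)\<close> with
  the rate \<open>a - m\<close>, which can be chosen as close to \<open>sur F - lip G\<close> as desired.
\<close>

section \<open>Cauchy sequences and locally closed sets\<close>

text \<open>
  The bound by a nonnegative decreasing function replaces geometric decay: it telescopes.
\<close>

lemma Cauchy_if_dist_le_decrease: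
  fixes f :: "nat \<Rightarrow> 'a::metric_space" and g :: "nat \<Rightarrow> real"
  assumes step: "\<And>n. dist (f n) (f (Suc n)) \<le> g n - g (Suc n)"
    and nonneg: "\<And>n. 0 \<le> g n"
  shows "Cauchy f"
proof -
  have tele: "dist (f n) (f (n + k)) \<le> g n - g (n + k)" for n k
  proof (induction k)
    case (Suc k)
    then show ?case
      using step[of "n + k"] dist_triangle[of "f n" "f (n + Suc k)" "f (n + k)"] by simp
  qed simp
  have "g (Suc n) \<le> g n" for n
    using step[of n] zero_le_dist[of "f n" "f (Suc n)"] by linarith
  then have "decseq g"
    by (simp add: decseq_Suc_iff)
  then obtain L where L: "g \<longlonglongrightarrow> L" "\<And>n. L \<le> g n"
    using decseq_convergent[of g 0] nonneg by blast
  show ?thesis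
  proof (rule metric_CauchyI)
    fix e :: real assume "e > 0"
    then have "\<forall>\<^sub>F n in sequentially. g n < L + e / 2"
      using L(1) by (intro order_tendstoD(2)) auto
    then obtain N where N: "g N < L + e / 2"
      by (auto simp: eventually_sequentially)
    have near: "dist (f N) (f n) < e / 2" if "n \<ge> N" for n
      using tele[of N "n - N"] that N L(2)[of n] by simp
    show "\<exists>M. \<forall>m\<ge>M. \<forall>n\<ge>M. dist (f m) (f n) < e"
      using near by (metis dist_commute dist_triangle_half_r)
  qed
qed

text \<open>
  Local closedness in the form in which the limit of the iteration uses it; in contrast to the
  closedness of a single set, it passes to smaller radii at once.
\<close>

lemma locally_closed_around_sequentially:
  fixes S :: "('a::metric_space \<times> 'b::metric_space) set"
  assumes "locally_closed_around S (a, b)"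
  obtains \<delta> where "\<delta> > 0"
    "\<And>u v x y. \<lbrakk>\<And>n. (u n, v n) \<in> S; \<And>n. dist a (u n) \<le> \<delta>; \<And>n. dist b (v n) \<le> \<delta>;
        u \<longlonglongrightarrow> x; v \<longlonglongrightarrow> y\<rbrakk> \<Longrightarrow> (x, y) \<in> S"
proof -
  obtain N where N: "(a, b) \<in> interior N" "closed (S \<inter> N)"
    using assms unfolding locally_closed_around_def by blast
  obtain A B where AB: "open A" "open B" "(a, b) \<in> A \<times> B" "A \<times> B \<subseteq> interior N"
    using open_prod_elim[OF open_interior N(1)] by metis
  obtain d e where de: "d > 0" "cball a d \<subseteq> A" "e > 0" "cball b e \<subseteq> B"
    using AB open_contains_cball by (metis mem_Sigma_iff)
  show thesis
  proof
    show "min d e > 0" using de by simp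
    fix u v x y
    assume S: "\<And>n. (u n, v n) \<in> S"
      and u: "\<And>n. dist a (u n) \<le> min d e" "u \<longlonglongrightarrow> x"
      and v: "\<And>n. dist b (v n) \<le> min d e" "v \<longlonglongrightarrow> y"
    have "u n \<in> A" "v n \<in> B" for n
      using de u(1)[of n] v(1)[of n] by (auto simp: subset_iff)
    then have "(u n, v n) \<in> S \<inter> N" for n
      using S AB(4) interior_subset[of N] by blast
    moreover have "(\<lambda>n. (u n, v n)) \<longlonglongrightarrow> (x, y)"
      by (intro tendsto_Pair u v)
    ultimately show "(x, y) \<in> S"
      using closed_sequentially[OF N(2), of "\<lambda>n. (u n, v n)"] by simp
  qed
qed

section \<open>Solving the inclusion by successive approximation\<close>

lemma edist_to_lessD:
  assumes "edist_to y C < ereal r"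
  obtains u where "u \<in> C" "dist y u < r"
  using assms unfolding edist_to_def by (auto simp: INF_less_iff)

text \<open>
  One step of the iteration, with \<open>s = r / (c + m)\<close> for the residual \<open>r = \<rho>(y + z, w)\<close>: then
  \<open>c s = r - m s\<close>, and \<open>m s\<close> bounds the new residual. The distance to \<open>G x'\<close> need not be attained,
  so the inequality for \<open>G\<close> has to be strict in order to produce \<open>z'\<close>; it therefore excludes
  \<open>x' = x\<close>, where \<open>z' = z\<close> serves.
\<close>

lemma residual_step:
  fixes F G :: "'x::metric_space \<Rightarrow> 'y::linear_metric_space set"
  assumes inv: "\<And>u v h :: 'y. dist (u + h) (v + h) = dist u v"
    and pos: "c > 0" "m > 0"
    and yz: "y \<in> F x" "z \<in> G x"
    and openF: "\<And>s. 0 < s \<Longrightarrow> s \<le> dist (y + z) w / (c + m) \<Longrightarrow>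
        cball y ((c + m) * s) \<subseteq> image_of F (cball x s)"
    and lipG: "\<And>x'. x' \<noteq> x \<Longrightarrow> dist x x' \<le> dist (y + z) w / (c + m) \<Longrightarrow>
        edist_to z (G x') < ereal (m * dist x x')"
  obtains x' z' where "w - z \<in> F x'" "z' \<in> G x'"
    "c * dist x x' \<le> dist (y + z) w - dist (w - z + z') w"
    "c * dist z z' \<le> m * (dist (y + z) w - dist (w - z + z') w)"
proof -
  define r where "r = dist (y + z) w"
  define s where "s = r / (c + m)"
  have r: "r = (c + m) * s"
    using pos by (simp add: s_def)
  have s0: "s \<ge> 0"
    using pos by (simp add: s_def r_def)
  have dist_y: "dist y (w - z) = r"
    using inv[of y z "w - z"] by (simp add: r_def)
  obtain x' where x': "w - z \<in> F x'" "dist x x' \<le> s"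
  proof (cases "s = 0")
    case True
    then have "y = w - z" using r dist_y by simp
    then show ?thesis using that[of x] yz True by simp
  next
    case False
    then have "s > 0" using s0 by simp
    then have "cball y ((c + m) * s) \<subseteq> image_of F (cball x s)"
      by (rule openF) (simp add: s_def r_def)
    moreover have "w - z \<in> cball y ((c + m) * s)"
      using dist_y r by simp
    ultimately have "w - z \<in> image_of F (cball x s)" by blast
    then show ?thesis using that by (auto simp: image_of_def)
  qed
  obtain z' where z': "z' \<in> G x'" "dist z z' \<le> m * dist x x'"
  proof (cases "x' = x")
    case True
    then show ?thesis using that[of z] yz by simp
  next
    case False
    then have "edist_to z (G x') < ereal (m * dist x x')"
      using x'(2) by (intro lipG) (auto simp: s_def r_def)
    then show ?thesis using that by (meson edist_to_lessD less_imp_le)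
  qed
  have r': "dist (w - z + z') w = dist z z'"
    using inv[of z' "w - z" z] by (simp add: dist_commute algebra_simps)
  have zs: "dist z z' \<le> m * s"
    using z'(2) mult_left_mono[OF x'(2), of m] pos by linarith
  have gain: "c * s \<le> r - dist (w - z + z') w"
    using zs r r' by (simp add: algebra_simps)
  show thesis
  proof
    show "c * dist x x' \<le> dist (y + z) w - dist (w - z + z') w"
      using gain mult_left_mono[OF x'(2), of c] pos unfolding r_def by linarith
    have "c * dist z z' \<le> c * (m * s)"
      using zs pos by simp
    also have "\<dots> = m * (c * s)" by simp
    also have "\<dots> \<le> m * (r - dist (w - z + z') w)"
      using gain pos by simp
    finally show "c * dist z z' \<le> m * (dist (y + z) w - dist (w - z + z') w)"
      by (simp add: r_def)
  qed (use x' z' in auto)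
qed

text \<open>
  The iteration itself. The invariant says that the displacement from the reference point plus
  what the current residual can still cause never exceeds the initial budget; so all iterates
  stay where the local hypotheses apply, and \<open>x\<close> never leaves the ball of radius \<open>t\<close>.
\<close>

lemma sum_covers_ball:
  fixes F G :: "'x::complete_space \<Rightarrow> 'y::{linear_metric_space, complete_space} set"
  assumes inv: "\<And>u v h :: 'y. dist (u + h) (v + h) = dist u v"
    and pos: "c > 0" "\<mu> < m" "m > 0"
    and yzb: "yb \<in> F xb" "zb \<in> G xb"
    and openF: "\<And>x y s. \<lbrakk>dist xb x \<le> \<delta>; dist yb y \<le> \<delta>; y \<in> F x; 0 < s; s < \<delta>\<rbrakk> \<Longrightarrow>
        cball y ((c + m) * s) \<subseteq> image_of F (cball x s)"
    and lipG: "\<And>x x' z. \<lbrakk>dist xb x \<le> \<delta>; dist xb x' \<le> \<delta>; z \<in> G x; dist zb z \<le> \<delta>\<rbrakk> \<Longrightarrow>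
        edist_to z (G x') \<le> ereal (\<mu> * dist x' x)"
    and closedF: "\<And>u v x y. \<lbrakk>\<And>n. (u n, v n) \<in> gph F; \<And>n. dist xb (u n) \<le> \<delta>;
        \<And>n. dist yb (v n) \<le> \<delta>; u \<longlonglongrightarrow> x; v \<longlonglongrightarrow> y\<rbrakk> \<Longrightarrow> (x, y) \<in> gph F"
    and closedG: "\<And>u v x z. \<lbrakk>\<And>n. (u n, v n) \<in> gph G; \<And>n. dist xb (u n) \<le> \<delta>;
        \<And>n. dist zb (v n) \<le> \<delta>; u \<longlonglongrightarrow> x; v \<longlonglongrightarrow> z\<rbrakk> \<Longrightarrow> (x, z) \<in> gph G"
    and t: "t > 0" "t \<le> \<delta>" "2 * (c + m) * t \<le> \<delta>"
  shows "cball (yb + zb) (c * t) \<subseteq> image_of (\<lambda>x. F x + G x) (cball xb t)"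
proof
  fix w assume "w \<in> cball (yb + zb) (c * t)"
  then have w: "dist (yb + zb) w \<le> c * t" by simp
  define Inv where "Inv = (\<lambda>(x, y, z). y \<in> F x \<and> z \<in> G x \<and>
      c * dist xb x + dist (y + z) w \<le> c * t \<and>
      c * dist zb z + m * dist (y + z) w \<le> m * (c * t))"
  define Step where "Step = (\<lambda>(x :: 'x, y, z) (x', y', z'). y' = w - z \<and>
      c * dist x x' \<le> dist (y + z) w - dist (y' + z') w \<and>
      c * dist z z' \<le> m * (dist (y + z) w - dist (y' + z') w))"
  have small: "2 * (c * t) + 2 * (m * t) \<le> \<delta>" "c * t > 0" "m * t > 0"
    using t pos by (simp_all add: algebra_simps)
  have near: "dist xb x \<le> t \<and> dist yb y \<le> \<delta> \<and> dist zb z \<le> \<delta> \<and> dist (y + z) w \<le> c * t"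
    if "Inv (x, y, z)" for x y z
  proof -
    have i: "c * dist xb x + dist (y + z) w \<le> c * t"
        "c * dist zb z + m * dist (y + z) w \<le> m * (c * t)"
      using that by (auto simp: Inv_def)
    have "c * dist xb x \<ge> 0"
      using pos by simp
    then have r: "dist (y + z) w \<le> c * t"
      using i(1) by linarith
    have "c * dist xb x \<le> c * t"
      using i(1) zero_le_dist[of "y + z" w] by linarith
    then have x: "dist xb x \<le> t" using pos by simp
    have "m * dist (y + z) w \<ge> 0"
      using pos by simp
    then have "c * dist zb z \<le> m * (c * t)"
      using i(2) by linarith
    also have "\<dots> = c * (m * t)"
      by simp
    finally have z: "dist zb z \<le> m * t" using pos by simp
    \<comment> \<open>The bound on \<open>y\<close> comes from those on \<open>z\<close> and on the initial and the current residual,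
      whence the radius \<open>m t + 2 c t\<close>.\<close>
    have "dist yb y = dist (yb + z) (y + z)" by (simp add: inv)
    also have "\<dots> \<le> dist (z + yb) (zb + yb) + dist (yb + zb) w + dist (y + z) w"
      using dist_triangle[of "yb + z" "y + z" w] dist_triangle[of "yb + z" w "yb + zb"]
      by (simp add: dist_commute add.commute)
    also have "\<dots> \<le> m * t + c * t + c * t"
      using z w r by (simp add: inv dist_commute)
    also have "\<dots> \<le> \<delta>"
      using small by linarith
    finally have y: "dist yb y \<le> \<delta>" .
    have "m * t \<le> \<delta>"
      using small by linarith
    with x y z r show ?thesis by simp
  qed
  have start: "Inv (xb, yb, zb)"
    using w yzb pos by (simp add: Inv_def)
  have step: "\<exists>q. Inv q \<and> Step p q" if "Inv p" for p
  proof -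
    obtain x y z where p: "p = (x, y, z)" by (cases p) auto
    have I: "Inv (x, y, z)" using that p by simp
    have yz: "y \<in> F x" "z \<in> G x" using I by (auto simp: Inv_def)
    have n: "dist xb x \<le> t" "dist yb y \<le> \<delta>" "dist zb z \<le> \<delta>" "dist (y + z) w \<le> c * t"
      using near[OF I] by auto
    have budget: "c * dist xb x + dist (y + z) w \<le> c * t"
      using I by (simp add: Inv_def)
    have "c * t < (c + m) * t" using pos t by simp
    then have "dist (y + z) w / (c + m) < t"
      using n(4) pos by (simp add: divide_less_eq mult.commute)
    \<comment> \<open>The Aubin inequality must be available at \<open>x'\<close> before it is known how the residual has
      decreased. The crude bound \<open>d(x, x') \<le> r / c\<close> is already covered by the budget.\<close>
    have rc: "dist (y + z) w / (c + m) \<le> dist (y + z) w / c"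
      using pos by (intro divide_left_mono) auto
    have bud2: "dist xb x + dist (y + z) w / c \<le> t"
      using budget pos by (simp add: field_simps)
    obtain x' z' where s: "w - z \<in> F x'" "z' \<in> G x'"
      "c * dist x x' \<le> dist (y + z) w - dist (w - z + z') w"
      "c * dist z z' \<le> m * (dist (y + z) w - dist (w - z + z') w)"
    proof (rule residual_step[where F = F and G = G and x = x and y = y and z = z and w = w,
          OF inv pos(1,3) yz])
      fix s assume "0 < s" "s \<le> dist (y + z) w / (c + m)"
      then show "cball y ((c + m) * s) \<subseteq> image_of F (cball x s)"
        using n t yz \<open>dist (y + z) w / (c + m) < t\<close> by (intro openF) auto
    next
      fix x' assume ne: "x' \<noteq> x" and le: "dist x x' \<le> dist (y + z) w / (c + m)"
      have "dist xb x' \<le> t"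
        using dist_triangle[of xb x' x] le rc bud2 by linarith
      then have "edist_to z (G x') \<le> ereal (\<mu> * dist x' x)"
        using n t yz by (intro lipG) auto
      also have "\<dots> < ereal (m * dist x x')"
        using pos ne by (simp add: dist_commute)
      finally show "edist_to z (G x') < ereal (m * dist x x')" .
    qed
    have "c * dist xb x' \<le> c * dist xb x + c * dist x x'"
      using pos dist_triangle[of xb x' x] by (simp flip: distrib_left)
    moreover have "c * dist zb z' \<le> c * dist zb z + c * dist z z'"
      using pos dist_triangle[of zb z' z] by (simp flip: distrib_left)
    ultimately have "Inv (x', w - z, z')"
      using I s unfolding Inv_def by (simp add: right_diff_distrib)
    then show ?thesis
      using s p unfolding Step_def by (intro exI[of _ "(x', w - z, z')"]) auto
  qed
  obtain f where f: "\<And>n. Inv (f n)" "\<And>n. Step (f n) (f (Suc n))"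
    using dependent_nat_choice[of "\<lambda>_. Inv" "\<lambda>_. Step"] start step by metis
  define u where "u n = fst (f n)" for n
  define v where "v n = fst (snd (f n))" for n
  define z where "z n = snd (snd (f n))" for n
  have fn: "f n = (u n, v n, z n)" for n by (simp add: u_def v_def z_def)
  have graphs: "(u n, v n) \<in> gph F" "(u n, z n) \<in> gph G" for n
    using f(1)[of n] by (auto simp: fn Inv_def gph_def)
  have bounds: "dist xb (u n) \<le> t" "dist yb (v n) \<le> \<delta>" "dist zb (z n) \<le> \<delta>" for n
    using near[of "u n" "v n" "z n"] f(1)[of n] by (auto simp: fn)
  define g where "g n = dist (v n + z n) w / c" for n
  have vSuc: "v (Suc n) = w - z n"
    and du: "c * dist (u n) (u (Suc n)) \<le> dist (v n + z n) w - dist (v (Suc n) + z (Suc n)) w"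
    and dz: "c * dist (z n) (z (Suc n)) \<le>
        m * (dist (v n + z n) w - dist (v (Suc n) + z (Suc n)) w)" for n
    using f(2)[of n] by (auto simp: fn Step_def)
  have "Cauchy u"
  proof (rule Cauchy_if_dist_le_decrease)
    show "dist (u n) (u (Suc n)) \<le> g n - g (Suc n)" for n
      using du[of n] pos by (simp add: g_def field_simps)
  qed (use pos in \<open>simp add: g_def\<close>)
  then obtain x where x: "u \<longlonglongrightarrow> x"
    using Cauchy_convergent convergent_def by blast
  have "Cauchy z"
  proof (rule Cauchy_if_dist_le_decrease)
    show "dist (z n) (z (Suc n)) \<le> m * g n - m * g (Suc n)" for n
      using dz[of n] pos by (simp add: g_def field_simps)
  qed (use pos in \<open>simp add: g_def\<close>)
  then obtain \<zeta> where \<zeta>: "z \<longlonglongrightarrow> \<zeta>"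
    using Cauchy_convergent convergent_def by blast
  have "(\<lambda>n. v (Suc n)) \<longlonglongrightarrow> w - \<zeta>"
    unfolding vSuc diff_conv_add_uminus by (intro tendsto_add tendsto_const tendsto_minus \<zeta>)
  \<comment> \<open>The limits add up to \<open>w\<close> because each new \<open>y\<close> is exactly \<open>w\<close> minus the previous \<open>z\<close>.\<close>
  then have v: "v \<longlonglongrightarrow> w - \<zeta>"
    by (simp only: filterlim_sequentially_Suc)
  have "dist xb (u n) \<le> \<delta>" for n
    using bounds(1)[of n] t by linarith
  then have "(x, w - \<zeta>) \<in> gph F" "(x, \<zeta>) \<in> gph G"
    using closedF[of u v] closedG[of u z] graphs bounds x v \<zeta> by blast+
  then have "w - \<zeta> + \<zeta> \<in> F x + G x"
    by (intro set_plus_intro) (auto simp: gph_def)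
  moreover have "dist xb x \<le> t"
    using bounds(1) by (intro Lim_bounded[OF tendsto_dist[OF tendsto_const x]]) auto
  ultimately show "w \<in> image_of (\<lambda>x. F x + G x) (cball xb t)"
    by (auto simp: image_of_def)
qed

section \<open>Comparison of the moduli\<close>

text \<open>
  A constant \<open>c < sur F - lip G\<close> is written as \<open>a - m\<close> with an openness
  rate \<open>a\<close> of \<open>F\<close> and \<open>m = a - c\<close>, which exceeds some Aubin constant of \<open>G\<close>.
\<close>

lemma le_lopen_sum:
  fixes F G :: "'x::complete_space \<Rightarrow> 'y::{linear_metric_space, complete_space} set"
  assumes inv: "shift_invariant_metric TYPE('y)"
    and F: "(xb, yb) \<in> gph F" "locally_closed_around (gph F) (xb, yb)"
    and G: "(xb, zb) \<in> gph G" "locally_closed_around (gph G) (xb, zb)"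
    and c: "c > 0" and lip: "lip G xb zb < ereal (a - c)"
    and a: "ereal a < sur F xb yb"
  shows "ereal c \<le> lopen (\<lambda>x. F x + G x) xb (yb + zb)"
proof -
  have inv': "dist (u + h) (v + h) = dist u v" for u v h :: 'y
    using inv by (simp add: shift_invariant_metric_def)
  define m where "m = a - c"
  obtain \<mu> UG VG where \<mu>': "\<mu> > 0" "ereal \<mu> < ereal m"
    and UG: "open UG" "xb \<in> UG" and VG: "open VG" "zb \<in> VG"
    and "\<forall>x\<in>UG. \<forall>x'\<in>UG. \<forall>z\<in>G x' \<inter> VG. edist_to z (G x) \<le> ereal (\<mu> * dist x x')"
    using lip unfolding lip_def Inf_less_iff m_def by blast
  then have lipG: "edist_to z (G x) \<le> ereal (\<mu> * dist x x')"
    if "x \<in> UG" "x' \<in> UG" "z \<in> G x'" "z \<in> VG" for x x' z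
    using that by blast
  have \<mu>: "\<mu> > 0" "\<mu> < m"
    using \<mu>' by auto
  have m: "m > 0" "a = c + m" "a > 0"
    using \<mu> c by (auto simp: m_def)
  obtain q where q: "ereal a < q" "q \<in> insert 0 {ereal b | b. b > 0 \<and>
     (\<exists>\<epsilon>>0. \<exists>U V. open U \<and> xb \<in> U \<and> open V \<and> yb \<in> V \<and>
        (\<forall>x\<in>U. \<forall>y\<in>V. y \<in> F x \<longrightarrow>
           (\<forall>t\<in>{0<..<\<epsilon>}. cball y (b * t) \<subseteq> image_of F (cball x t))))}"
    using a unfolding sur_def less_Sup_iff by blast
  then have "q \<noteq> 0"
    using m(3) by auto
  with q obtain b \<epsilon> UF VF where b': "ereal a < ereal b" and \<epsilon>: "\<epsilon> > 0"
    and UF: "open UF" "xb \<in> UF" and VF: "open VF" "yb \<in> VF"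
    and "\<forall>x\<in>UF. \<forall>y\<in>VF. y \<in> F x \<longrightarrow>
           (\<forall>t\<in>{0<..<\<epsilon>}. cball y (b * t) \<subseteq> image_of F (cball x t))"
    by blast
  then have openF: "cball y (b * t) \<subseteq> image_of F (cball x t)"
    if "x \<in> UF" "y \<in> VF" "y \<in> F x" "0 < t" "t < \<epsilon>" for x y t
    using that by simp
  have b: "a < b"
    using b' by simp
  obtain \<delta>F where \<delta>F: "\<delta>F > 0" and closedF: "\<And>u v x y. \<lbrakk>\<And>n. (u n, v n) \<in> gph F;
      \<And>n. dist xb (u n) \<le> \<delta>F; \<And>n. dist yb (v n) \<le> \<delta>F; u \<longlonglongrightarrow> x; v \<longlonglongrightarrow> y\<rbrakk> \<Longrightarrow> (x, y) \<in> gph F"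
    using locally_closed_around_sequentially[OF F(2)] by metis
  obtain \<delta>G where \<delta>G: "\<delta>G > 0" and closedG: "\<And>u v x z. \<lbrakk>\<And>n. (u n, v n) \<in> gph G;
      \<And>n. dist xb (u n) \<le> \<delta>G; \<And>n. dist zb (v n) \<le> \<delta>G; u \<longlonglongrightarrow> x; v \<longlonglongrightarrow> z\<rbrakk> \<Longrightarrow> (x, z) \<in> gph G"
    using locally_closed_around_sequentially[OF G(2)] by metis
  obtain \<delta>X where \<delta>X: "\<delta>X > 0" "cball xb \<delta>X \<subseteq> UF \<inter> UG"
    using UF UG open_contains_cball by (metis IntI open_Int)
  obtain \<delta>Y where \<delta>Y: "\<delta>Y > 0" "cball yb \<delta>Y \<subseteq> VF"
    using VF open_contains_cball by blast
  obtain \<delta>Z where \<delta>Z: "\<delta>Z > 0" "cball zb \<delta>Z \<subseteq> VG"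
    using VG open_contains_cball by blast
  define \<delta> where "\<delta> = Min {\<epsilon>, \<delta>F, \<delta>G, \<delta>X, \<delta>Y, \<delta>Z}"
  have \<delta>: "\<delta> > 0" "\<delta> \<le> \<epsilon>" "\<delta> \<le> \<delta>F" "\<delta> \<le> \<delta>G" "\<delta> \<le> \<delta>X" "\<delta> \<le> \<delta>Y" "\<delta> \<le> \<delta>Z"
    using \<epsilon> \<delta>F \<delta>G \<delta>X \<delta>Y \<delta>Z by (auto simp: \<delta>_def)
  have inX: "x \<in> UF" "x \<in> UG" if "dist xb x \<le> \<delta>" for x
    using that \<delta>(5) \<delta>X(2) by (auto simp: subset_iff)
  have inY: "y \<in> VF" if "dist yb y \<le> \<delta>" for y
    using that \<delta>(6) \<delta>Y(2) by (auto simp: subset_iff)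
  have inZ: "z \<in> VG" if "dist zb z \<le> \<delta>" for z
    using that \<delta>(7) \<delta>Z(2) by (auto simp: subset_iff)
  \<comment> \<open>While \<open>x\<close> moves by at most \<open>t\<close>, the values in \<open>F x\<close> and \<open>G x\<close> move by at most \<open>2 a t\<close>;
    this must not exceed \<open>\<delta>\<close>.\<close>
  have "cball (yb + zb) (c * t) \<subseteq> image_of (\<lambda>x. F x + G x) (cball xb t)"
    if t: "0 < t" "t < min \<delta> (\<delta> / (2 * a))" for t
  proof (rule sum_covers_ball[OF inv' c \<mu>(2) m(1)])
    show "yb \<in> F xb" "zb \<in> G xb"
      using F(1) G(1) by (auto simp: gph_def)
  next
    fix x y s assume as: "dist xb x \<le> \<delta>" "dist yb y \<le> \<delta>" "y \<in> F x" "0 < s" "s < \<delta>"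
    have "(c + m) * s \<le> b * s"
      using b m as by simp
    then have "cball y ((c + m) * s) \<subseteq> cball y (b * s)"
      by auto
    also have "\<dots> \<subseteq> image_of F (cball x s)"
      using as \<delta>(2) by (intro openF inX inY) auto
    finally show "cball y ((c + m) * s) \<subseteq> image_of F (cball x s)" .
  next
    fix x x' z assume "dist xb x \<le> \<delta>" "dist xb x' \<le> \<delta>" "z \<in> G x" "dist zb z \<le> \<delta>"
    then show "edist_to z (G x') \<le> ereal (\<mu> * dist x' x)"
      by (intro lipG inX inZ)
  next
    fix u v x y
    assume as: "\<And>n. (u n, v n) \<in> gph F" "\<And>n. dist xb (u n) \<le> \<delta>"
      "\<And>n. dist yb (v n) \<le> \<delta>" "u \<longlonglongrightarrow> x" "v \<longlonglongrightarrow> y"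
    show "(x, y) \<in> gph F"
      by (rule closedF[OF as(1) order_trans[OF as(2) \<delta>(3)] order_trans[OF as(3) \<delta>(3)] as(4,5)])
  next
    fix u v x z
    assume as: "\<And>n. (u n, v n) \<in> gph G" "\<And>n. dist xb (u n) \<le> \<delta>"
      "\<And>n. dist zb (v n) \<le> \<delta>" "u \<longlonglongrightarrow> x" "v \<longlonglongrightarrow> z"
    show "(x, z) \<in> gph G"
      by (rule closedG[OF as(1) order_trans[OF as(2) \<delta>(4)] order_trans[OF as(3) \<delta>(4)] as(4,5)])
  next
    show "t > 0" "t \<le> \<delta>" "2 * (c + m) * t \<le> \<delta>"
      using t m(3) by (simp_all add: less_divide_eq mult.commute flip: m(2))
  qed
  moreover have "min \<delta> (\<delta> / (2 * a)) > 0"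
    using \<delta> m by simp
  ultimately have "\<exists>\<epsilon>>0. \<forall>t\<in>{0<..<\<epsilon>}.
      cball (yb + zb) (c * t) \<subseteq> image_of (\<lambda>x. F x + G x) (cball xb t)"
    by (intro exI[of _ "min \<delta> (\<delta> / (2 * a))"] conjI ballI) (simp_all del: min_less_iff_conj)
  then show ?thesis
    unfolding lopen_def using c by (intro Sup_upper) auto
qed

theorem theorem4p5:
  fixes F G :: "'x::complete_space \<Rightarrow> 'y::{linear_metric_space, complete_space} set"
    and xb :: 'x and yb zb :: 'y
  assumes "shift_invariant_metric TYPE('y)"
    and "(xb, yb) \<in> gph F" and "locally_closed_around (gph F) (xb, yb)"
    and "(xb, zb) \<in> gph G" and "locally_closed_around (gph G) (xb, zb)"
  shows "\<not> (sur F xb yb = \<infinity> \<and> lip G xb zb = \<infinity>) \<longrightarrow>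
    lopen (\<lambda>x. F x + G x) xb (yb + zb) \<ge> sur F xb yb - lip G xb zb"
proof (rule impI, rule dense_le)
  fix e
  assume fin: "\<not> (sur F xb yb = \<infinity> \<and> lip G xb zb = \<infinity>)"
    and e: "e < sur F xb yb - lip G xb zb"
  show "e \<le> lopen (\<lambda>x. F x + G x) xb (yb + zb)"
  proof (cases "e \<le> 0")
    case True
    also have "0 \<le> lopen (\<lambda>x. F x + G x) xb (yb + zb)"
      unfolding lopen_def by (intro Sup_upper) simp
    finally show ?thesis .
  next
    case False
    then obtain c where c: "e = ereal c" "c > 0"
      using e by (cases e) auto
    have "0 \<le> lip G xb zb"
      unfolding lip_def by (auto intro!: Inf_greatest)
    then obtain L where L: "lip G xb zb = ereal L"
      using fin e by (cases "lip G xb zb"; cases "sur F xb yb") auto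
    have "ereal (c + L) < sur F xb yb"
      using e c L by (cases "sur F xb yb") auto
    then obtain a where a: "ereal (c + L) < ereal a" "ereal a < sur F xb yb"
      using ereal_dense2 by blast
    show ?thesis
      unfolding c(1) using a L by (intro le_lopen_sum[OF assms c(2)]) auto
  qed
qed

end
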